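(* For every positive integer $n$, the quandle $R_\infty$ is an Alexander extension of $R_n$ by $R_\infty$; that is, there is $\phi\in Z^2_{\rm TQ}(R_n;R_\infty)$ such that $R_\infty$ is isomorphic as a quandle to $AE(R_n,R_\infty,\phi)$.
   Context: A quandle is a set $X$ with a binary operation $*$ such that (I) $a*a=a$; (II) for all $a,b$ there is a unique $c$ with $a=c*b$; (III) $(a*b)*c=(a*c)*(b*c)$. Let $\Lambda=\mathbb{Z}[T,T^{-1}]$. An Alexander quandle is a $\Lambda$-module $M$ with operation $a*b=Ta+(1-T)b$. $R_\infty$ is $\mathbb{Z}$ with $a*b=2b-a$, and the dihedral quandle $R_n$ is $\mathbb{Z}_n=\mathbb{Z}/n\mathbb{Z}$ with $a*b=2b-a \pmod n$; both are Alexander quandles with $T$ acting as multiplication by $-1$. For a quandle $X$ and a $\Lambda$-module $A$, $Z^2_{\rm TQ}(X;A)$ is the set of functions $\phi:X\times X\to A$ with $\phi(x,x)=0$ for all $x$ and $$T\phi(x_1,x_2)+\phi(x_1*x_2,x_3)=T\phi(x_1,x_3)+(1-T)\phi(x_2,x_3)+\phi(x_1*x_3,x_2*x_3)$$ for all $x_1,x_2,x_3\in X$. For such $\phi$, the Alexander extension $AE(X,A,\phi)$ of $X$ by $(A,\phi)$ is the quandle on the set $A\times X$ with $(a_1,x_1)*(a_2,x_2)=(a_1*a_2+\phi(x_1,x_2),\,x_1*x_2)$. *)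

theory Defs
  imports "HOL-Algebra.Module" "HOL-Algebra.Elementary_Groups" "HOL-Library.Poly_Mapping"
begin

record 'a quandle = "'a partial_object" +
  qop :: "'a \<Rightarrow> 'a \<Rightarrow> 'a"  (infixl "\<star>\<index>" 70)

locale quandle =
  fixes X (structure)
  assumes closed [simp, intro]:
      "\<lbrakk>a \<in> carrier X; b \<in> carrier X\<rbrakk> \<Longrightarrow> a \<star> b \<in> carrier X"
    and idem: "a \<in> carrier X \<Longrightarrow> a \<star> a = a"
    and right_div: "\<lbrakk>a \<in> carrier X; b \<in> carrier X\<rbrakk> \<Longrightarrow> \<exists>!c. c \<in> carrier X \<and> a = c \<star> b"
    and right_distrib:
      "\<lbrakk>a \<in> carrier X; b \<in> carrier X; c \<in> carrier X\<rbrakk>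
        \<Longrightarrow> (a \<star> b) \<star> c = (a \<star> c) \<star> (b \<star> c)"

definition quandle_hom :: "('a, 'm) quandle_scheme \<Rightarrow> ('b, 'n) quandle_scheme \<Rightarrow> ('a \<Rightarrow> 'b) set"
  where "quandle_hom X Y =
    {f \<in> carrier X \<rightarrow> carrier Y.
       \<forall>a\<in>carrier X. \<forall>b\<in>carrier X. f (a \<star>\<^bsub>X\<^esub> b) = f a \<star>\<^bsub>Y\<^esub> f b}"

definition quandle_iso :: "('a, 'm) quandle_scheme \<Rightarrow> ('b, 'n) quandle_scheme \<Rightarrow> ('a \<Rightarrow> 'b) set"
  where "quandle_iso X Y = {f \<in> quandle_hom X Y. bij_betw f (carrier X) (carrier Y)}"

definition quandle_isomorphic ::
    "('a, 'm) quandle_scheme \<Rightarrow> ('b, 'n) quandle_scheme \<Rightarrow> bool"  (infix "\<cong>\<^sub>Q" 50)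
  where "X \<cong>\<^sub>Q Y \<longleftrightarrow> quandle_iso X Y \<noteq> {}"

text \<open>The Laurent polynomials over the integers: finitely supported maps from exponents (in
  \<^typ>\<open>int\<close>) to coefficients, with the convolution product of \<^typ>\<open>int \<Rightarrow>\<^sub>0 int\<close>.\<close>

type_synonym laurent = "int \<Rightarrow>\<^sub>0 int"

definition Laurent :: "laurent ring"  ("\<Lambda>")
  where "\<Lambda> = \<lparr>carrier = UNIV, mult = (*), one = 1, zero = 0, add = (+)\<rparr>"

definition laurent_T :: laurent  ("\<T>")
  where "\<T> = Poly_Mapping.single 1 1"

definition alexander_quandle :: "(laurent, 'a, 'm) module_scheme \<Rightarrow> 'a quandle"
  where "alexander_quandle M =
    \<lparr>carrier = carrier M,
     qop = (\<lambda>a b. (\<T> \<odot>\<^bsub>M\<^esub> a) \<oplus>\<^bsub>M\<^esub> ((1 - \<T>) \<odot>\<^bsub>M\<^esub> b))\<rparr>"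

definition R_infinity :: "int quandle"  ("R\<^sub>\<infinity>")
  where "R\<^sub>\<infinity> = \<lparr>carrier = UNIV, qop = (\<lambda>a b. 2 * b - a)\<rparr>"

definition dihedral_quandle :: "nat \<Rightarrow> int quandle"
  where "dihedral_quandle n =
    \<lparr>carrier = carrier (integer_mod_group n), qop = (\<lambda>a b. (2 * b - a) mod int n)\<rparr>"

text \<open>The integers as a \<open>\<Lambda>\<close>-module with \<open>\<T>\<close> acting as multiplication by \<open>-1\<close>, so that
  a Laurent polynomial acts through its value at \<open>-1\<close>. The fields \<open>mult\<close> and \<open>one\<close> are part
  of the module record but irrelevant to the module structure.\<close>

definition eval_neg1 :: "laurent \<Rightarrow> int"
  where "eval_neg1 p =
    (\<Sum>k\<in>Poly_Mapping.keys p. Poly_Mapping.lookup p k * (if even k then 1 else - 1))"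

definition R_infinity_module :: "(laurent, int) module"
  where "R_infinity_module =
    \<lparr>carrier = UNIV, mult = (*), one = 1, zero = 0, add = (+),
     smult = (\<lambda>p x. eval_neg1 p * x)\<rparr>"

text \<open>Functions of two variables on the carrier of \<open>X\<close> are made \<open>undefined\<close> outside it, so that
  each cocycle is represented once.\<close>

definition Z2_TQ ::
    "('x, 'm) quandle_scheme \<Rightarrow> (laurent, 'a, 'n) module_scheme \<Rightarrow> ('x \<times> 'x \<Rightarrow> 'a) set"
  where "Z2_TQ X A =
    {\<phi> \<in> carrier X \<times> carrier X \<rightarrow>\<^sub>E carrier A.
       (\<forall>x\<in>carrier X. \<phi> (x, x) = \<zero>\<^bsub>A\<^esub>) \<and>
       (\<forall>x\<^sub>1\<in>carrier X. \<forall>x\<^sub>2\<in>carrier X. \<forall>x\<^sub>3\<in>carrier X.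
          (\<T> \<odot>\<^bsub>A\<^esub> \<phi> (x\<^sub>1, x\<^sub>2)) \<oplus>\<^bsub>A\<^esub> \<phi> (x\<^sub>1 \<star>\<^bsub>X\<^esub> x\<^sub>2, x\<^sub>3) =
          (\<T> \<odot>\<^bsub>A\<^esub> \<phi> (x\<^sub>1, x\<^sub>3)) \<oplus>\<^bsub>A\<^esub> ((1 - \<T>) \<odot>\<^bsub>A\<^esub> \<phi> (x\<^sub>2, x\<^sub>3))
            \<oplus>\<^bsub>A\<^esub> \<phi> (x\<^sub>1 \<star>\<^bsub>X\<^esub> x\<^sub>3, x\<^sub>2 \<star>\<^bsub>X\<^esub> x\<^sub>3))}"

definition alexander_extension ::
    "('x, 'm) quandle_scheme \<Rightarrow> (laurent, 'a, 'n) module_scheme \<Rightarrow> ('x \<times> 'x \<Rightarrow> 'a)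
      \<Rightarrow> ('a \<times> 'x) quandle"
  where "alexander_extension X A \<phi> =
    \<lparr>carrier = carrier A \<times> carrier X,
     qop = (\<lambda>(a\<^sub>1, x\<^sub>1) (a\<^sub>2, x\<^sub>2).
       ((a\<^sub>1 \<star>\<^bsub>alexander_quandle A\<^esub> a\<^sub>2) \<oplus>\<^bsub>A\<^esub> \<phi> (x\<^sub>1, x\<^sub>2), x\<^sub>1 \<star>\<^bsub>X\<^esub> x\<^sub>2))\<rparr>"


lemma cring_Laurent: "cring \<Lambda>"
  unfolding Laurent_def
  by (rule cringI; (rule abelian_groupI comm_monoidI)?)
    (auto simp: algebra_simps intro: exI[of _ "- x" for x])

lemma eval_neg1_conv_sum:
  assumes "finite S" "Poly_Mapping.keys p \<subseteq> S"
  shows "eval_neg1 p = (\<Sum>k\<in>S. Poly_Mapping.lookup p k * (if even k then 1 else - 1))"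
  unfolding eval_neg1_def
  using assms by (intro sum.mono_neutral_left) (auto simp: in_keys_iff)

lemma eval_neg1_add: "eval_neg1 (p + q) = eval_neg1 p + eval_neg1 q"
proof -
  let ?S = "Poly_Mapping.keys p \<union> Poly_Mapping.keys q"
  have "Poly_Mapping.keys (p + q) \<subseteq> ?S"
    by (rule keys_add)
  then show ?thesis
    by (simp add: eval_neg1_conv_sum[of ?S] lookup_add sum.distrib algebra_simps split del: if_split)
qed

lemma eval_neg1_0 [simp]: "eval_neg1 0 = 0"
  by (simp add: eval_neg1_def)

lemma eval_neg1_diff: "eval_neg1 (p - q) = eval_neg1 p - eval_neg1 q"
  using eval_neg1_add[of "p - q" q] by simp

lemma eval_neg1_single:
  "eval_neg1 (Poly_Mapping.single k c) = c * (if even k then 1 else - 1)"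
  by (simp add: eval_neg1_def)

lemma eval_neg1_1 [simp]: "eval_neg1 1 = 1"
  using eval_neg1_single[of 0 1] by simp

lemma eval_neg1_T [simp]: "eval_neg1 \<T> = - 1"
  by (simp add: laurent_T_def eval_neg1_single)

lemma eval_neg1_mult: "eval_neg1 (p * q) = eval_neg1 p * eval_neg1 q"
proof (rule frag_induction[OF subset_UNIV, of _ p])
  fix k :: int
  show "eval_neg1 (frag_of k * q) = eval_neg1 (frag_of k) * eval_neg1 q"
    by (rule frag_induction[OF subset_UNIV, of _ q])
      (auto simp: mult_single eval_neg1_single eval_neg1_diff algebra_simps)
qed (auto simp: eval_neg1_diff algebra_simps)

lemma module_R_infinity: "module \<Lambda> R_infinity_module"
proof (rule moduleI[OF cring_Laurent])
  show "abelian_group R_infinity_module"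
    by (rule abelian_groupI)
      (auto simp: R_infinity_module_def algebra_simps intro: exI[of _ "- x" for x])
qed (auto simp: R_infinity_module_def Laurent_def eval_neg1_add eval_neg1_mult algebra_simps)

lemma alexander_quandle_R_infinity: "alexander_quandle R_infinity_module = R\<^sub>\<infinity>"
  by (simp add: alexander_quandle_def R_infinity_module_def R_infinity_def eval_neg1_diff
      fun_eq_iff)

lemma quandle_R_infinity: "quandle R\<^sub>\<infinity>"
proof
  show "\<exists>!c. c \<in> carrier R\<^sub>\<infinity> \<and> a = c \<star>\<^bsub>R\<^sub>\<infinity>\<^esub> b" for a b
    by (rule ex1I[of _ "2 * b - a"]) (auto simp: R_infinity_def)
qed (auto simp: R_infinity_def algebra_simps)

lemma quandle_dihedral_quandle:
  assumes "n > 0"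
  shows "quandle (dihedral_quandle n)"
proof
  fix a b c
  assume ab: "a \<in> carrier (dihedral_quandle n)" "b \<in> carrier (dihedral_quandle n)"
  let ?X = "dihedral_quandle n"
  show "a \<star>\<^bsub>?X\<^esub> b \<in> carrier ?X"
    using assms by (simp add: dihedral_quandle_def carrier_integer_mod_group)
  show "a \<star>\<^bsub>?X\<^esub> a = a"
    using assms ab by (simp add: dihedral_quandle_def carrier_integer_mod_group)
  show "\<exists>!c. c \<in> carrier ?X \<and> a = c \<star>\<^bsub>?X\<^esub> b"
  proof (rule ex1I[of _ "(2 * b - a) mod int n"])
    show "(2 * b - a) mod int n \<in> carrier ?X \<and> a = (2 * b - a) mod int n \<star>\<^bsub>?X\<^esub> b"
      using assms ab by (simp add: dihedral_quandle_def carrier_integer_mod_group mod_simps)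
  next
    fix c assume "c \<in> carrier ?X \<and> a = c \<star>\<^bsub>?X\<^esub> b"
    then show "c = (2 * b - a) mod int n"
      using assms by (auto simp: dihedral_quandle_def carrier_integer_mod_group mod_simps)
  qed
  show "(a \<star>\<^bsub>?X\<^esub> b) \<star>\<^bsub>?X\<^esub> c = (a \<star>\<^bsub>?X\<^esub> c) \<star>\<^bsub>?X\<^esub> (b \<star>\<^bsub>?X\<^esub> c)"
  proof -
    have "(2 * c - (2 * b - a) mod int n) mod int n = (2 * c - (2 * b - a)) mod int n"
      by (simp add: mod_simps)
    also have "\<dots> = (2 * (2 * c - b) - (2 * c - a)) mod int n"
      by (simp add: algebra_simps)
    also have "\<dots> = (2 * ((2 * c - b) mod int n) - (2 * c - a) mod int n) mod int n"
      by (intro mod_diff_cong) (simp_all only: mod_mult_right_eq mod_mod_trivial)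
    finally show ?thesis
      by (simp add: dihedral_quandle_def)
  qed
qed

lemma quandle_alexander_extension:
  assumes X: "quandle X" and A: "module \<Lambda> A" and \<phi>: "\<phi> \<in> Z2_TQ X A"
  shows "quandle (alexander_extension X A \<phi>)"
proof -
  interpret X: quandle X by fact
  interpret A: module \<Lambda> A by fact
  have carr [simp]: "p \<in> carrier \<Lambda>" for p
    by (simp add: Laurent_def)
  define t where "t a = \<T> \<odot>\<^bsub>A\<^esub> a" for a
  define t' where "t' a = Poly_Mapping.single (- 1) 1 \<odot>\<^bsub>A\<^esub> a" for a
  have tc [simp]: "t a \<in> carrier A" if "a \<in> carrier A" for a
    using that by (simp add: t_def)
  have tc' [simp]: "t' a \<in> carrier A" if "a \<in> carrier A" for a
    using that by (simp add: t'_def)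
  have tt' [simp]: "t (t' a) = a" if "a \<in> carrier A" for a
    using that A.smult_assoc1[of "\<T>" "Poly_Mapping.single (- 1) 1" a] A.smult_one[of a]
    by (simp add: t_def t'_def Laurent_def laurent_T_def mult_single)
  have t't [simp]: "t' (t a) = a" if "a \<in> carrier A" for a
    using that A.smult_assoc1[of "Poly_Mapping.single (- 1) 1" "\<T>" a] A.smult_one[of a]
    by (simp add: t_def t'_def Laurent_def laurent_T_def mult_single)
  have t_add: "t (a \<oplus>\<^bsub>A\<^esub> b) = t a \<oplus>\<^bsub>A\<^esub> t b" if "a \<in> carrier A" "b \<in> carrier A" for a b
    using that by (simp add: t_def A.smult_r_distr)
  have t_minus: "t (\<ominus>\<^bsub>A\<^esub> a) = \<ominus>\<^bsub>A\<^esub> t a" if "a \<in> carrier A" for a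
    using that by (simp add: t_def A.smult_r_minus)
  have t1: "(1 - \<T>) \<odot>\<^bsub>A\<^esub> a = a \<oplus>\<^bsub>A\<^esub> \<ominus>\<^bsub>A\<^esub> t a" if a: "a \<in> carrier A" for a
  proof -
    have "(1 - \<T>) \<odot>\<^bsub>A\<^esub> a \<oplus>\<^bsub>A\<^esub> t a = a"
      using A.smult_l_distr[of "1 - \<T>" "\<T>" a] A.smult_one[of a] a
      by (simp add: t_def Laurent_def)
    then show ?thesis
      using a by (metis A.add.inv_solve_right A.smult_closed carr tc)
  qed
  have \<phi>c [simp]: "\<phi> (x, y) \<in> carrier A" if "x \<in> carrier X" "y \<in> carrier X" for x y
    using \<phi> that by (auto simp: Z2_TQ_def PiE_iff)
  have \<phi>0: "\<phi> (x, x) = \<zero>\<^bsub>A\<^esub>" if "x \<in> carrier X" for x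
    using \<phi> that by (auto simp: Z2_TQ_def)
  have cocycle: "t (\<phi> (x, y)) \<oplus>\<^bsub>A\<^esub> \<phi> (x \<star>\<^bsub>X\<^esub> y, z) =
      t (\<phi> (x, z)) \<oplus>\<^bsub>A\<^esub> (\<phi> (y, z) \<oplus>\<^bsub>A\<^esub> \<ominus>\<^bsub>A\<^esub> t (\<phi> (y, z))) \<oplus>\<^bsub>A\<^esub> \<phi> (x \<star>\<^bsub>X\<^esub> z, y \<star>\<^bsub>X\<^esub> z)"
    if "x \<in> carrier X" "y \<in> carrier X" "z \<in> carrier X" for x y z
    using \<phi> that t1[of "\<phi> (y, z)"] by (auto simp: Z2_TQ_def t_def)
  define E where "E = alexander_extension X A \<phi>"
  have carrE: "carrier E = carrier A \<times> carrier X"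
    by (simp add: E_def alexander_extension_def)
  have opE: "(a, x) \<star>\<^bsub>E\<^esub> (b, y) = (t a \<oplus>\<^bsub>A\<^esub> (b \<oplus>\<^bsub>A\<^esub> \<ominus>\<^bsub>A\<^esub> t b) \<oplus>\<^bsub>A\<^esub> \<phi> (x, y), x \<star>\<^bsub>X\<^esub> y)"
    if "b \<in> carrier A" for a b x y
    using that t1[of b] by (simp add: E_def alexander_extension_def alexander_quandle_def t_def)
  note ac = A.M.add.m_ac A.M.minus_add t_add t_minus A.M.r_neg A.M.r_neg1 A.M.r_neg2
  have cancel2: "a \<oplus>\<^bsub>A\<^esub> (b \<oplus>\<^bsub>A\<^esub> (\<ominus>\<^bsub>A\<^esub> a \<oplus>\<^bsub>A\<^esub> c)) = b \<oplus>\<^bsub>A\<^esub> c"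
    if "a \<in> carrier A" "b \<in> carrier A" "c \<in> carrier A" for a b c
    using that A.M.add.m_lcomm[of a b "\<ominus>\<^bsub>A\<^esub> a \<oplus>\<^bsub>A\<^esub> c"] by (simp add: A.M.r_neg2)
  have cancel3: "a \<oplus>\<^bsub>A\<^esub> (b \<oplus>\<^bsub>A\<^esub> (c \<oplus>\<^bsub>A\<^esub> (\<ominus>\<^bsub>A\<^esub> a \<oplus>\<^bsub>A\<^esub> d))) = b \<oplus>\<^bsub>A\<^esub> (c \<oplus>\<^bsub>A\<^esub> d)"
    if "a \<in> carrier A" "b \<in> carrier A" "c \<in> carrier A" "d \<in> carrier A" for a b c d
    using that A.M.add.m_lcomm[of a b "c \<oplus>\<^bsub>A\<^esub> (\<ominus>\<^bsub>A\<^esub> a \<oplus>\<^bsub>A\<^esub> d)"] by (simp add: cancel2)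
  have cancel4: "a \<oplus>\<^bsub>A\<^esub> (b \<oplus>\<^bsub>A\<^esub> (c \<oplus>\<^bsub>A\<^esub> (d \<oplus>\<^bsub>A\<^esub> (\<ominus>\<^bsub>A\<^esub> a \<oplus>\<^bsub>A\<^esub> e)))) = b \<oplus>\<^bsub>A\<^esub> (c \<oplus>\<^bsub>A\<^esub> (d \<oplus>\<^bsub>A\<^esub> e))"
    if "a \<in> carrier A" "b \<in> carrier A" "c \<in> carrier A" "d \<in> carrier A" "e \<in> carrier A"
    for a b c d e
    using that A.M.add.m_lcomm[of a b "c \<oplus>\<^bsub>A\<^esub> (d \<oplus>\<^bsub>A\<^esub> (\<ominus>\<^bsub>A\<^esub> a \<oplus>\<^bsub>A\<^esub> e))"] by (simp add: cancel3)
  have "quandle E"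
  proof
    fix u v assume "u \<in> carrier E" "v \<in> carrier E"
    then show "u \<star>\<^bsub>E\<^esub> v \<in> carrier E"
      by (auto simp: carrE opE)
  next
    fix u assume "u \<in> carrier E"
    then show "u \<star>\<^bsub>E\<^esub> u = u"
      by (auto simp: carrE opE X.idem \<phi>0 ac)
  next
    fix u v assume "u \<in> carrier E" "v \<in> carrier E"
    then obtain a x b y where uv: "u = (a, x)" "v = (b, y)"
      and c: "a \<in> carrier A" "x \<in> carrier X" "b \<in> carrier A" "y \<in> carrier X"
      by (auto simp: carrE)
    from X.right_div[OF c(2,4)] obtain z where z: "z \<in> carrier X" "x = z \<star>\<^bsub>X\<^esub> y"
      and zu: "\<And>w. w \<in> carrier X \<Longrightarrow> x = w \<star>\<^bsub>X\<^esub> y \<Longrightarrow> w = z"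
      by blast
    define r where "r = (b \<oplus>\<^bsub>A\<^esub> \<ominus>\<^bsub>A\<^esub> t b) \<oplus>\<^bsub>A\<^esub> \<phi> (z, y)"
    have r: "r \<in> carrier A"
      using c z by (simp add: r_def)
    show "\<exists>!w. w \<in> carrier E \<and> u = w \<star>\<^bsub>E\<^esub> v"
    proof (rule ex1I[of _ "(t' (a \<oplus>\<^bsub>A\<^esub> \<ominus>\<^bsub>A\<^esub> r), z)"])
      have "a = (a \<oplus>\<^bsub>A\<^esub> \<ominus>\<^bsub>A\<^esub> r) \<oplus>\<^bsub>A\<^esub> r"
        using c r by (simp add: A.M.add.m_assoc A.M.l_neg)
      then have "a = (a \<oplus>\<^bsub>A\<^esub> \<ominus>\<^bsub>A\<^esub> r) \<oplus>\<^bsub>A\<^esub> (b \<oplus>\<^bsub>A\<^esub> \<ominus>\<^bsub>A\<^esub> t b) \<oplus>\<^bsub>A\<^esub> \<phi> (z, y)"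
        using c z r by (simp add: r_def A.M.add.m_assoc)
      then show "(t' (a \<oplus>\<^bsub>A\<^esub> \<ominus>\<^bsub>A\<^esub> r), z) \<in> carrier E \<and>
          u = (t' (a \<oplus>\<^bsub>A\<^esub> \<ominus>\<^bsub>A\<^esub> r), z) \<star>\<^bsub>E\<^esub> v"
        using c z r by (simp add: carrE opE uv)
    next
      fix w assume w: "w \<in> carrier E \<and> u = w \<star>\<^bsub>E\<^esub> v"
      obtain d y' where d: "w = (d, y')" "d \<in> carrier A" "y' \<in> carrier X"
        using w by (auto simp: carrE)
      have "y' = z"
        using w d c by (auto simp: uv opE intro: zu)
      then have "a = t d \<oplus>\<^bsub>A\<^esub> r"
        using w d c z by (auto simp: uv opE r_def A.M.add.m_assoc)
      then have "t d = a \<oplus>\<^bsub>A\<^esub> \<ominus>\<^bsub>A\<^esub> r"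
        using d r by (simp add: A.M.add.m_assoc A.M.r_neg)
      then show "w = (t' (a \<oplus>\<^bsub>A\<^esub> \<ominus>\<^bsub>A\<^esub> r), z)"
        using d \<open>y' = z\<close> t't by metis
    qed
  next
    fix u v w assume "u \<in> carrier E" "v \<in> carrier E" "w \<in> carrier E"
    then obtain a x b y c z where uvw: "u = (a, x)" "v = (b, y)" "w = (c, z)"
      and C: "a \<in> carrier A" "x \<in> carrier X" "b \<in> carrier A" "y \<in> carrier X"
        "c \<in> carrier A" "z \<in> carrier X"
      by (auto simp: carrE)
    define k where "k = t (t a) \<oplus>\<^bsub>A\<^esub> (t b \<oplus>\<^bsub>A\<^esub> \<ominus>\<^bsub>A\<^esub> t (t b)) \<oplus>\<^bsub>A\<^esub> (c \<oplus>\<^bsub>A\<^esub> \<ominus>\<^bsub>A\<^esub> t c)"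
    have "fst ((u \<star>\<^bsub>E\<^esub> v) \<star>\<^bsub>E\<^esub> w) = k \<oplus>\<^bsub>A\<^esub> (t (\<phi> (x, y)) \<oplus>\<^bsub>A\<^esub> \<phi> (x \<star>\<^bsub>X\<^esub> y, z))"
      using C by (simp add: uvw opE k_def ac)
    also have "\<dots> = fst ((u \<star>\<^bsub>E\<^esub> w) \<star>\<^bsub>E\<^esub> (v \<star>\<^bsub>E\<^esub> w))"
      unfolding cocycle[OF C(2,4,6)]
      using C by (simp add: uvw opE k_def ac cancel2 cancel3 cancel4)
    finally show "(u \<star>\<^bsub>E\<^esub> v) \<star>\<^bsub>E\<^esub> w = (u \<star>\<^bsub>E\<^esub> w) \<star>\<^bsub>E\<^esub> (v \<star>\<^bsub>E\<^esub> w)"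
      using C X.right_distrib[OF C(2,4,6)] by (intro prod_eqI) (simp_all add: uvw opE)
  qed
  then show ?thesis
    by (simp add: E_def)
qed

end

theory Submission
  imports Defs
begin

text \<open>Division with remainder, \<open>m \<mapsto> (m div n, m mod n)\<close>, is a bijection from the integers onto
  the pairs of an integer and a residue. Writing two integers as \<open>n a + x\<close> and \<open>n b + y\<close>, the
  product \<open>2 (n b + y) - (n a + x) = n (2 b - a) + (2 y - x)\<close> has quotient
  \<open>(2 b - a) + (2 y - x) div n\<close> and remainder \<open>(2 y - x) mod n\<close>. Hence the bijection is an
  isomorphism onto the extension by the carry \<open>\<phi> (x, y) = (2 y - x) div n\<close>. The same quotient
  formula, \<open>reflection_div\<close>, gives the cocycle condition: both sides are equal to
  \<open>(2 x\<^sub>3 - 2 x\<^sub>2 + x\<^sub>1) div n\<close>, the quotient of the two bracketings in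
  self-distributivity of \<open>R\<^sub>\<infinity>\<close>.\<close>

lemma reflection_div:
  fixes x y d :: int
  assumes "d \<noteq> 0"
  shows "(2 * y - x) div d = 2 * (y div d) - x div d + (2 * (y mod d) - x mod d) div d"
proof -
  have "2 * y - x = (2 * (y mod d) - x mod d) + (2 * (y div d) - x div d) * d"
    unfolding minus_mult_div_eq_mod[symmetric] by (simp only: algebra_simps)
  then have "(2 * y - x) div d
      = ((2 * (y mod d) - x mod d) + (2 * (y div d) - x div d) * d) div d"
    by (rule arg_cong)
  then show ?thesis
    by (simp only: div_mult_self1[OF assms])
qed

text \<open>The carry cocycle, restricted to pairs of residues.\<close>

definition carry_cocycle :: "nat \<Rightarrow> int \<times> int \<Rightarrow> int"
  where "carry_cocycle n =
    restrict (\<lambda>(x, y). (2 * y - x) div int n) ({0..<int n} \<times> {0..<int n})"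

lemma carry_cocycle_apply:
  assumes "x \<in> {0..<int n}" "y \<in> {0..<int n}"
  shows "carry_cocycle n (x, y) = (2 * y - x) div int n"
  using assms by (simp add: carry_cocycle_def)

lemma carrier_dihedral_quandle:
  assumes "n > 0"
  shows "carrier (dihedral_quandle n) = {0..<int n}"
  using assms by (simp add: dihedral_quandle_def carrier_integer_mod_group)

lemma carry_cocycle_in_Z2_TQ:
  assumes "n > 0"
  shows "carry_cocycle n \<in> Z2_TQ (dihedral_quandle n) R_infinity_module"
proof -
  have cocycle: "- carry_cocycle n (x, y) + carry_cocycle n ((2 * y - x) mod int n, z)
      = - carry_cocycle n (x, z) + 2 * carry_cocycle n (y, z)
        + carry_cocycle n ((2 * z - x) mod int n, (2 * z - y) mod int n)"
    if "x \<in> {0..<int n}" "y \<in> {0..<int n}" "z \<in> {0..<int n}" for x y z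
  proof -
    have "(2 * z - (2 * y - x)) div int n
        = - ((2 * y - x) div int n) + (2 * z - (2 * y - x) mod int n) div int n"
      using reflection_div[of "int n" z "2 * y - x"] that assms by simp
    moreover have "(2 * (2 * z - y) - (2 * z - x)) div int n
        = 2 * ((2 * z - y) div int n) - (2 * z - x) div int n
          + (2 * ((2 * z - y) mod int n) - (2 * z - x) mod int n) div int n"
      using assms by (intro reflection_div) simp
    moreover have "2 * z - (2 * y - x) = 2 * (2 * z - y) - (2 * z - x)"
      by simp
    ultimately show ?thesis
      using that assms by (simp add: carry_cocycle_apply)
  qed
  have "carry_cocycle n (x, x) = 0" if "x \<in> {0..<int n}" for x
    using that by (simp add: carry_cocycle_apply)
  moreover have "carry_cocycle n \<in> {0..<int n} \<times> {0..<int n} \<rightarrow>\<^sub>E UNIV"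
    by (simp add: carry_cocycle_def)
  ultimately show ?thesis
    using cocycle unfolding Z2_TQ_def carrier_dihedral_quandle[OF assms]
    by (simp add: R_infinity_module_def dihedral_quandle_def eval_neg1_diff)
qed

lemma bij_betw_div_mod:
  fixes d :: int
  assumes "d > 0"
  shows "bij_betw (\<lambda>m. (m div d, m mod d)) UNIV (UNIV \<times> {0..<d})"
proof (rule bij_betw_byWitness[where f' = "\<lambda>(a, x). d * a + x"])
  show "\<forall>p\<in>UNIV \<times> {0..<d}. (\<lambda>m. (m div d, m mod d)) ((\<lambda>(a, x). d * a + x) p) = p"
    using assms by (auto simp: div_add1_eq)
qed (use assms in auto)

theorem proposition5p5:
  fixes n :: nat
  assumes "n > 0"
  shows "\<exists>\<phi> \<in> Z2_TQ (dihedral_quandle n) R_infinity_module.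
    R\<^sub>\<infinity> \<cong>\<^sub>Q alexander_extension (dihedral_quandle n) R_infinity_module \<phi>"
proof
  show "carry_cocycle n \<in> Z2_TQ (dihedral_quandle n) R_infinity_module"
    using assms by (rule carry_cocycle_in_Z2_TQ)
next
  define E where
    "E = alexander_extension (dihedral_quandle n) R_infinity_module (carry_cocycle n)"
  define f where "f = (\<lambda>m. (m div int n, m mod int n))"
  have carrier_E: "carrier E = UNIV \<times> {0..<int n}"
    using assms by (simp add: E_def alexander_extension_def carrier_dihedral_quandle
        R_infinity_module_def)
  have op_E: "(a, x) \<star>\<^bsub>E\<^esub> (b, y)
      = (2 * b - a + carry_cocycle n (x, y), (2 * y - x) mod int n)" for a x b y
    by (simp add: E_def alexander_extension_def alexander_quandle_R_infinity R_infinity_def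
        dihedral_quandle_def) (simp add: R_infinity_module_def)
  have "f (2 * b - a) = f a \<star>\<^bsub>E\<^esub> f b" for a b
  proof -
    have "(2 * b - a) mod int n = (2 * (b mod int n) - a mod int n) mod int n"
      by (intro mod_diff_cong) (simp_all add: mod_mult_right_eq)
    then show ?thesis
      using assms reflection_div[of "int n" b a]
      by (simp add: f_def op_E carry_cocycle_apply)
  qed
  moreover have "bij_betw f UNIV (carrier E)"
    using assms unfolding f_def carrier_E by (intro bij_betw_div_mod) simp
  ultimately have "f \<in> quandle_iso R\<^sub>\<infinity> E"
    by (auto simp: quandle_iso_def quandle_hom_def R_infinity_def bij_betw_apply)
  then show "R\<^sub>\<infinity> \<cong>\<^sub>Q alexander_extension (dihedral_quandle n) R_infinity_module
      (carry_cocycle n)"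
    unfolding E_def quandle_isomorphic_def by blast
qed

end
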